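(* Let $(W,S)$ be a Coxeter system of type $\Lambda$ and let $\alpha$ be a link. Then the braid graph $\mathcal{B}(\alpha)$ is a median graph.
   Context: A Coxeter system $(W,S)$ consists of a finite set $S$ and the group $W=\langle S\mid (st)^{m(s,t)}=e\rangle$, where $m(s,s)=1$ and $m(s,t)=m(t,s)\in\{2,3,\dots\}\cup\{\infty\}$ for $s\neq t$ ($m(s,t)=\infty$ means no relation). Its Coxeter graph has vertex set $S$ and an edge $\{s,t\}$ whenever $m(s,t)\ge 3$. $(W,S)$ is of type $\Lambda$ if $m(s,t)\le 3$ for all $s,t\in S$ (simply laced) and the Coxeter graph contains no three-cycles (triangle free). A reduced expression for $w\in W$ is a word over $S$ of minimal length representing $w$. A braid move replaces three consecutive letters $sts$ by $tst$, where $m(s,t)=3$. Two reduced expressions are braid equivalent if they are related by a finite sequence of braid moves; $[\alpha]$ denotes the braid class (equivalence class) of $\alpha$. The braid graph $\mathcal{B}(\alpha)$ has vertex set $[\alpha]$, with two vertices adjacent if and only if they are related by a single braid move. A braid shadow for a reduced expression $\alpha$ is a set of positions $\{i-1,i,i+1\}$ such that the letters of $\alpha$ in these positions form $sts$ with $m(s,t)=3$. $\mathcal{S}(\alpha)$ is the set of braid shadows for $\alpha$, and $\mathcal{S}([\alpha])=\bigcup_{\beta\in[\alpha]}\mathcal{S}(\beta)$. A reduced expression $\alpha$ of length $m\ge 1$ is a link if either $m=1$, or $m$ is odd and $\mathcal{S}([\alpha])=\{\{1,2,3\},\{3,4,5\},\dots,\{m-2,m-1,m\}\}$. In a connected graph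 $G$ with path metric $d$, the interval between vertices is $I(u,v)=\{w\in V(G)\mid d(u,v)=d(u,w)+d(w,v)\}$. $G$ is median if $|I(u,v)\cap I(u,w)\cap I(v,w)|=1$ for all $u,v,w\in V(G)$. *)

theory Defs
  imports "HOL-Algebra.Group" "HOL-Library.Extended_Nat"
begin

section \<open>Groups given by generators and relations\<close>

text \<open>A letter \<open>(s, True)\<close> stands for the generator \<open>s\<close>, and \<open>(s, False)\<close> for its formal inverse.\<close>

type_synonym 'a gword = "('a \<times> bool) list"

definition gwords :: "'a set \<Rightarrow> 'a gword set" where
  "gwords S = lists (S \<times> UNIV)"

inductive_set pres_rel :: "'a set \<Rightarrow> 'a gword set \<Rightarrow> ('a gword \<times> 'a gword) set"
  for S :: "'a set" and R :: "'a gword set" where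
  refl: "u \<in> gwords S \<Longrightarrow> (u, u) \<in> pres_rel S R"
| sym: "(u, v) \<in> pres_rel S R \<Longrightarrow> (v, u) \<in> pres_rel S R"
| trans: "(u, v) \<in> pres_rel S R \<Longrightarrow> (v, w) \<in> pres_rel S R \<Longrightarrow> (u, w) \<in> pres_rel S R"
| cancel: "u \<in> gwords S \<Longrightarrow> v \<in> gwords S \<Longrightarrow> s \<in> S
    \<Longrightarrow> (u @ [(s, b), (s, \<not> b)] @ v, u @ v) \<in> pres_rel S R"
| relator: "u \<in> gwords S \<Longrightarrow> v \<in> gwords S \<Longrightarrow> r \<in> R \<Longrightarrow> r \<in> gwords S
    \<Longrightarrow> (u @ r @ v, u @ v) \<in> pres_rel S R"

definition presented_group :: "'a set \<Rightarrow> 'a gword set \<Rightarrow> 'a gword set monoid" where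
  "presented_group S R =
     \<lparr> carrier = gwords S // pres_rel S R,
       mult = (\<lambda>A B. \<Union>u\<in>A. \<Union>v\<in>B. pres_rel S R `` {u @ v}),
       one = pres_rel S R `` {[]} \<rparr>"

lemma pres_rel_gwords:
  assumes "(u, v) \<in> pres_rel S R"
  shows "u \<in> gwords S \<and> v \<in> gwords S"
  using assms by induction (auto simp: gwords_def)

lemma equiv_pres_rel: "equiv (gwords S) (pres_rel S R)"
proof (rule equivI)
  show "pres_rel S R \<subseteq> gwords S \<times> gwords S"
    using pres_rel_gwords by fastforce
  show "refl_on (gwords S) (pres_rel S R)"
    by (rule refl_onI) (rule pres_rel.refl)
  show "Relation.sym (pres_rel S R)"
    by (rule symI) (rule pres_rel.sym)
  show "Relation.trans (pres_rel S R)"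
    by (rule transI) (rule pres_rel.trans)
qed

lemma pres_rel_context:
  assumes "(u, v) \<in> pres_rel S R" "x \<in> gwords S" "y \<in> gwords S"
  shows "(x @ u @ y, x @ v @ y) \<in> pres_rel S R"
  using assms(1)
proof induction
  case (refl u)
  then show ?case using assms by (auto intro!: pres_rel.refl simp: gwords_def)
next
  case (cancel u v s b)
  then show ?case
    using assms pres_rel.cancel[of "x @ u" S "v @ y" s b R] by (auto simp: gwords_def)
next
  case (relator u v r)
  then show ?case
    using assms pres_rel.relator[of "x @ u" S "v @ y" r R] by (auto simp: gwords_def)
qed (blast intro: pres_rel.sym pres_rel.trans)+

lemma pres_rel_append:
  assumes "(u, u') \<in> pres_rel S R" "(v, v') \<in> pres_rel S R"
  shows "(u @ v, u' @ v') \<in> pres_rel S R"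
  using pres_rel_context[OF assms(1), of "[]" v] pres_rel_context[OF assms(2), of u' "[]"]
    pres_rel_gwords[OF assms(1)] pres_rel_gwords[OF assms(2)]
  by (auto intro: pres_rel.trans simp: gwords_def)

lemma presented_group_mult:
  assumes "u \<in> gwords S" "v \<in> gwords S"
  shows "(pres_rel S R `` {u}) \<otimes>\<^bsub>presented_group S R\<^esub> (pres_rel S R `` {v})
           = pres_rel S R `` {u @ v}"
proof -
  have "congruent2 (pres_rel S R) (pres_rel S R) (\<lambda>u v. pres_rel S R `` {u @ v})"
    by (rule congruent2I') (simp add: equiv_class_eq[OF equiv_pres_rel] pres_rel_append)
  then show ?thesis
    using UN_equiv_class2[OF equiv_pres_rel equiv_pres_rel _ assms]
    by (simp add: presented_group_def)
qed

lemma pres_rel_inverse: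
  assumes "u \<in> gwords S"
  shows "(rev (map (\<lambda>(s, b). (s, \<not> b)) u) @ u, []) \<in> pres_rel S R"
  using assms
proof (induction u)
  case Nil
  then show ?case by (auto intro: pres_rel.refl)
next
  case (Cons a u)
  obtain s b where a: "a = (s, b)" by fastforce
  let ?i = "rev (map (\<lambda>(s, b). (s, \<not> b)) u)"
  have "?i \<in> gwords S" "u \<in> gwords S" "s \<in> S"
    using Cons.prems a by (auto simp: gwords_def)
  then have "(?i @ [(s, \<not> b), (s, \<not> \<not> b)] @ u, ?i @ u) \<in> pres_rel S R"
    by (rule pres_rel.cancel)
  then show ?case using Cons \<open>u \<in> gwords S\<close> a by (auto intro: pres_rel.trans)
qed

lemma group_presented_group: "group (presented_group S R)"
proof -
  let ?G = "presented_group S R" and ?c = "\<lambda>u. pres_rel S R `` {u}"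
  have car: "carrier ?G = ?c ` gwords S" and one: "\<one>\<^bsub>?G\<^esub> = ?c []"
    by (auto simp: presented_group_def quotient_def)
  have nil: "[] \<in> gwords S" and app: "\<And>u v. u \<in> gwords S \<Longrightarrow> v \<in> gwords S \<Longrightarrow> u @ v \<in> gwords S"
    by (auto simp: gwords_def)
  show ?thesis
  proof (rule groupI)
    fix x assume "x \<in> carrier ?G"
    then obtain u where u: "u \<in> gwords S" "x = ?c u" using car by auto
    let ?i = "rev (map (\<lambda>(s, b). (s, \<not> b)) u)"
    have "?i \<in> gwords S" using u by (auto simp: gwords_def)
    moreover have "?c (?i @ u) = ?c []"
      by (rule equiv_class_eq[OF equiv_pres_rel pres_rel_inverse[OF u(1)]])
    ultimately show "\<exists>y\<in>carrier ?G. y \<otimes>\<^bsub>?G\<^esub> x = \<one>\<^bsub>?G\<^esub>"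
      using u car one by (auto simp: presented_group_mult intro!: bexI[of _ "?c ?i"])
  qed (auto simp: car one nil app presented_group_mult)
qed

section \<open>Coxeter systems\<close>

text \<open>A Coxeter system is given by its Coxeter matrix; the group is then the presented group
  \<open>coxeter_group\<close>. An entry \<open>\<infinity>\<close> contributes no relator.\<close>

definition coxeter_system :: "'a set \<Rightarrow> ('a \<Rightarrow> 'a \<Rightarrow> enat) \<Rightarrow> bool" where
  "coxeter_system S m \<longleftrightarrow> finite S \<and> (\<forall>s\<in>S. m s s = 1) \<and>
     (\<forall>s\<in>S. \<forall>t\<in>S. s \<noteq> t \<longrightarrow> m s t = m t s \<and> m s t \<ge> 2)"

definition coxeter_relators :: "'a set \<Rightarrow> ('a \<Rightarrow> 'a \<Rightarrow> enat) \<Rightarrow> 'a gword set" where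
  "coxeter_relators S m =
     {concat (replicate k [(s, True), (t, True)]) | s t k. s \<in> S \<and> t \<in> S \<and> m s t = enat k}"

definition coxeter_group :: "'a set \<Rightarrow> ('a \<Rightarrow> 'a \<Rightarrow> enat) \<Rightarrow> 'a gword set monoid" where
  "coxeter_group S m = presented_group S (coxeter_relators S m)"

definition coxeter_edge :: "'a set \<Rightarrow> ('a \<Rightarrow> 'a \<Rightarrow> enat) \<Rightarrow> 'a \<Rightarrow> 'a \<Rightarrow> bool" where
  "coxeter_edge S m s t \<longleftrightarrow> s \<in> S \<and> t \<in> S \<and> s \<noteq> t \<and> m s t \<ge> 3"

definition type_Lambda :: "'a set \<Rightarrow> ('a \<Rightarrow> 'a \<Rightarrow> enat) \<Rightarrow> bool" where
  "type_Lambda S m \<longleftrightarrow> (\<forall>s\<in>S. \<forall>t\<in>S. m s t \<le> 3) \<and>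
     \<not> (\<exists>s t u. coxeter_edge S m s t \<and> coxeter_edge S m t u \<and> coxeter_edge S m u s)"

section \<open>Reduced expressions, braid classes and links\<close>

definition generator :: "'a set \<Rightarrow> ('a \<Rightarrow> 'a \<Rightarrow> enat) \<Rightarrow> 'a \<Rightarrow> 'a gword set" where
  "generator S m s = pres_rel S (coxeter_relators S m) `` {[(s, True)]}"

definition word_value :: "'a set \<Rightarrow> ('a \<Rightarrow> 'a \<Rightarrow> enat) \<Rightarrow> 'a list \<Rightarrow> 'a gword set" where
  "word_value S m \<alpha> =
     foldr (\<lambda>s x. generator S m s \<otimes>\<^bsub>coxeter_group S m\<^esub> x) \<alpha> \<one>\<^bsub>coxeter_group S m\<^esub>"

definition reduced :: "'a set \<Rightarrow> ('a \<Rightarrow> 'a \<Rightarrow> enat) \<Rightarrow> 'a list \<Rightarrow> bool" where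
  "reduced S m \<alpha> \<longleftrightarrow> \<alpha> \<in> lists S \<and>
     (\<forall>\<beta>\<in>lists S. word_value S m \<beta> = word_value S m \<alpha> \<longrightarrow> length \<alpha> \<le> length \<beta>)"

definition braid_moves :: "'a set \<Rightarrow> ('a \<Rightarrow> 'a \<Rightarrow> enat) \<Rightarrow> ('a list \<times> 'a list) set" where
  "braid_moves S m =
     {(u @ [s, t, s] @ v, u @ [t, s, t] @ v) | u v s t. s \<in> S \<and> t \<in> S \<and> m s t = 3}"

definition braid_class :: "'a set \<Rightarrow> ('a \<Rightarrow> 'a \<Rightarrow> enat) \<Rightarrow> 'a list \<Rightarrow> 'a list set" where
  "braid_class S m \<alpha> = {\<beta>. reduced S m \<beta> \<and> (\<alpha>, \<beta>) \<in> (braid_moves S m)\<^sup>*}"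

definition braid_graph_edges ::
    "'a set \<Rightarrow> ('a \<Rightarrow> 'a \<Rightarrow> enat) \<Rightarrow> 'a list \<Rightarrow> ('a list \<times> 'a list) set" where
  "braid_graph_edges S m \<alpha> =
     {(\<beta>, \<gamma>). \<beta> \<in> braid_class S m \<alpha> \<and> \<gamma> \<in> braid_class S m \<alpha> \<and> (\<beta>, \<gamma>) \<in> braid_moves S m}"

text \<open>Positions in a word are counted from \<open>1\<close>, so position \<open>i\<close> carries the letter \<open>\<alpha> ! (i - 1)\<close>.\<close>

definition braid_shadows :: "('a \<Rightarrow> 'a \<Rightarrow> enat) \<Rightarrow> 'a list \<Rightarrow> nat set set" where
  "braid_shadows m \<alpha> =
     {{i - 1, i, i + 1} | i. 2 \<le> i \<and> i + 1 \<le> length \<alpha> \<and>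
        (\<exists>s t. \<alpha> ! (i - 2) = s \<and> \<alpha> ! (i - 1) = t \<and> \<alpha> ! i = s \<and> m s t = 3)}"

definition class_shadows :: "'a set \<Rightarrow> ('a \<Rightarrow> 'a \<Rightarrow> enat) \<Rightarrow> 'a list \<Rightarrow> nat set set" where
  "class_shadows S m \<alpha> = (\<Union>\<beta>\<in>braid_class S m \<alpha>. braid_shadows m \<beta>)"

definition link :: "'a set \<Rightarrow> ('a \<Rightarrow> 'a \<Rightarrow> enat) \<Rightarrow> 'a list \<Rightarrow> bool" where
  "link S m \<alpha> \<longleftrightarrow> reduced S m \<alpha> \<and> length \<alpha> \<ge> 1 \<and>
     (length \<alpha> = 1 \<or>
      odd (length \<alpha>) \<and>
      class_shadows S m \<alpha> = {{2*k - 1, 2*k, 2*k + 1} | k. 1 \<le> k \<and> 2*k + 1 \<le> length \<alpha>})"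

section \<open>Median graphs\<close>

text \<open>A simple graph is a vertex set together with a symmetric irreflexive relation on it.\<close>

definition simple_graph :: "'v set \<Rightarrow> ('v \<times> 'v) set \<Rightarrow> bool" where
  "simple_graph V E \<longleftrightarrow> E \<subseteq> V \<times> V \<and> sym E \<and> irrefl E"

definition connected_graph :: "'v set \<Rightarrow> ('v \<times> 'v) set \<Rightarrow> bool" where
  "connected_graph V E \<longleftrightarrow> simple_graph V E \<and> V \<noteq> {} \<and> (\<forall>u\<in>V. \<forall>v\<in>V. (u, v) \<in> E\<^sup>*)"

text \<open>The distance is only meaningful for vertices in the same connected component.\<close>

definition graph_dist :: "('v \<times> 'v) set \<Rightarrow> 'v \<Rightarrow> 'v \<Rightarrow> nat" where
  "graph_dist E u v = (LEAST n. (u, v) \<in> E ^^ n)"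

definition graph_interval :: "'v set \<Rightarrow> ('v \<times> 'v) set \<Rightarrow> 'v \<Rightarrow> 'v \<Rightarrow> 'v set" where
  "graph_interval V E u v = {w \<in> V. graph_dist E u v = graph_dist E u w + graph_dist E w v}"

definition median_graph :: "'v set \<Rightarrow> ('v \<times> 'v) set \<Rightarrow> bool" where
  "median_graph V E \<longleftrightarrow> connected_graph V E \<and>
     (\<forall>u\<in>V. \<forall>v\<in>V. \<forall>w\<in>V.
        card (graph_interval V E u v \<inter> graph_interval V E u w \<inter> graph_interval V E v w) = 1)"

end

theory Submission
  imports Defs
begin

text \<open>
  A braid class of a link of length \<open>2*r + 1\<close> is the set of proper list colourings of a path.

  Count positions from \<open>0\<close>. Every braid move in the class of a link then acts on a triple of
  positions \<open>2*k\<close>, \<open>2*k + 1\<close>, \<open>2*k + 2\<close>, so the letter at the centre \<open>2*k + 1\<close> changes only under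
  moves at \<open>k\<close>, and the flank \<open>2*k\<close> only under moves at \<open>k - 1\<close> and \<open>k\<close>. Triangle-freeness forces all
  moves at \<open>k\<close> in the class to exchange the same two letters (\<open>pair_at_active\<close>): if between
  two moves at \<open>k\<close> the left flank changed from \<open>t\<close> to \<open>t'\<close> while the centre stayed \<open>s\<close>, then \<open>t\<close> and \<open>t'\<close>
  would be the letters of moves at \<open>k - 1\<close>, and \<open>s\<close>, \<open>t\<close>, \<open>t'\<close> would form a three-cycle. Call these
  two letters the palette of \<open>k\<close>.

  Since adjacent letters of a reduced word differ and no shadow is centred at an even position,
  the palettes of \<open>k\<close> and \<open>k + 1\<close> are different and the centres \<open>k\<close> and \<open>k + 1\<close> never carry the same
  letter; moreover the flank between two centres is determined by their letters
  (\<open>flank_between\<close>). So the sequence of centres is a proper colouring of the path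
  \<open>0, \<dots>, r - 1\<close> by its palettes, it determines the word (\<open>colouring_inj\<close>), and the move at \<open>k\<close> is
  possible exactly when recolouring \<open>k\<close> leaves the colouring proper (\<open>active_if_recolourable\<close>).

  From a proper colouring one can always move one step closer to any other, because on a path
  the obstructions to single recolourings cannot form a cycle (\<open>legal_recolouring\<close>).
  Hence all proper colourings occur, and the braid graph sits isometrically in a hypercube.
  Properness constrains only pairs of neighbouring coordinates, so it is preserved by coordinatewise
  majority (\<open>proper_majority\<close>), and the majority of three vertices of an isometric subgraph of a
  hypercube is their unique median (\<open>binary_coordinates.median\<close>).
\<close>

section \<open>Median graphs from binary coordinates\<close>

text \<open>
  An isometric embedding of a graph into a hypercube whose image is closed under majority. The
  two values of a coordinate are left unnamed: it is enough that no coordinate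
  takes three values, and this avoids choosing an origin.
\<close>

locale binary_coordinates =
  fixes V :: "'v set" and E :: "('v \<times> 'v) set" and n :: nat and f :: "'v \<Rightarrow> nat \<Rightarrow> 'c"
  assumes nonempty: "V \<noteq> {}"
    and edge_vertices: "E \<subseteq> V \<times> V"
    and edge_sym: "(u, v) \<in> E \<Longrightarrow> (v, u) \<in> E"
    and edge_coordinate: "(u, v) \<in> E \<Longrightarrow> \<exists>k. {i. i < n \<and> f u i \<noteq> f v i} = {k}"
    and coordinates_inj: "\<lbrakk>u \<in> V; v \<in> V; \<And>k. k < n \<Longrightarrow> f u k = f v k\<rbrakk> \<Longrightarrow> u = v"
    and two_values: "\<lbrakk>u \<in> V; v \<in> V; w \<in> V; k < n\<rbrakk>
      \<Longrightarrow> f u k = f v k \<or> f u k = f w k \<or> f v k = f w k"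
    and step_towards: "\<lbrakk>u \<in> V; v \<in> V; u \<noteq> v\<rbrakk>
      \<Longrightarrow> \<exists>x k. (u, x) \<in> E \<and> k < n \<and> f u k \<noteq> f v k \<and> f x k = f v k \<and>
                (\<forall>i<n. i \<noteq> k \<longrightarrow> f x i = f u i)"
    and majority: "\<lbrakk>u \<in> V; v \<in> V; w \<in> V\<rbrakk>
      \<Longrightarrow> \<exists>x\<in>V. \<forall>k<n. (f u k = f v k \<longrightarrow> f x k = f u k) \<and>
                (f u k = f w k \<longrightarrow> f x k = f u k) \<and> (f v k = f w k \<longrightarrow> f x k = f v k)"
begin

definition diff :: "'v \<Rightarrow> 'v \<Rightarrow> nat set" where
  "diff u v = {i. i < n \<and> f u i \<noteq> f v i}"

lemma finite_diff [simp]: "finite (diff u v)"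
  by (simp add: diff_def)

text \<open>The distance is the number of differing coordinates: an edge changes only one coordinate, and
  a step towards the target is always available.\<close>

lemma walk_length_ge: "(u, v) \<in> E ^^ l \<Longrightarrow> card (diff u v) \<le> l"
proof (induction l arbitrary: v)
  case 0
  then show ?case by (simp add: diff_def)
next
  case (Suc l)
  then obtain x where x: "(u, x) \<in> E ^^ l" "(x, v) \<in> E" by auto
  from edge_coordinate[OF x(2)] obtain k where "diff x v = {k}" unfolding diff_def ..
  moreover have "diff u v \<subseteq> diff u x \<union> diff x v" by (auto simp: diff_def)
  ultimately have "diff u v \<subseteq> insert k (diff u x)" by simp
  then have "card (diff u v) \<le> card (insert k (diff u x))" by (intro card_mono) auto
  also have "\<dots> \<le> Suc (card (diff u x))" by (rule card_insert_le_m1) auto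
  finally show ?case using Suc.IH[OF x(1)] by simp
qed

lemma walk_exists: "\<lbrakk>u \<in> V; v \<in> V\<rbrakk> \<Longrightarrow> (u, v) \<in> E ^^ card (diff u v)"
proof (induction "card (diff u v)" arbitrary: u)
  case 0
  then have "u = v" by (intro coordinates_inj) (auto simp: diff_def)
  then show ?case by (simp add: diff_def)
next
  case (Suc l)
  then have "u \<noteq> v" by (auto simp: diff_def)
  from step_towards[OF Suc.prems this] obtain x k where
    x: "(u, x) \<in> E" "k < n" "f u k \<noteq> f v k" "f x k = f v k" "\<forall>i<n. i \<noteq> k \<longrightarrow> f x i = f u i"
    by blast
  then have "diff u v = insert k (diff x v)" "k \<notin> diff x v"
    by (auto simp: diff_def)
  then have l: "card (diff x v) = l" using Suc(2) by simp
  moreover have "x \<in> V" using x(1) edge_vertices by auto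
  ultimately have "(x, v) \<in> E ^^ l" using Suc.hyps(1)[of x] Suc.prems by simp
  then have "(u, v) \<in> E ^^ Suc l" using x(1) by (rule relpow_Suc_I2[rotated])
  then show ?case using Suc(2) by simp
qed

lemma graph_dist_eq:
  assumes "u \<in> V" "v \<in> V"
  shows "graph_dist E u v = card (diff u v)"
  unfolding graph_dist_def
  using walk_exists[OF assms] walk_length_ge by (rule Least_equality)

text \<open>Intervals are subcubes: the triangle inequality for the distances through \<open>x\<close> is an
  equality iff no coordinate is changed on the way to \<open>x\<close> and changed back afterwards.\<close>

lemma mem_graph_interval:
  assumes "u \<in> V" "v \<in> V"
  shows "x \<in> graph_interval V E u v \<longleftrightarrow> x \<in> V \<and> (\<forall>k<n. f u k = f v k \<longrightarrow> f x k = f u k)"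
proof (cases "x \<in> V")
  case True
  have sub: "diff u v \<subseteq> diff u x \<union> diff x v" by (auto simp: diff_def)
  have "card (diff u v) = card (diff u x) + card (diff x v) \<longleftrightarrow>
      (\<forall>k<n. f u k = f v k \<longrightarrow> f x k = f u k)" (is "?L \<longleftrightarrow> ?R")
  proof
    assume ?L
    moreover have "card (diff u x \<union> diff x v) \<le> card (diff u x) + card (diff x v)"
      by (rule card_Un_le)
    ultimately have "diff u v = diff u x \<union> diff x v"
      using sub by (intro card_seteq) auto
    then show ?R by (auto simp: diff_def)
  next
    assume R: ?R
    then have "diff u v = diff u x \<union> diff x v" by (force simp: diff_def)
    moreover have "diff u x \<inter> diff x v = {}"
      using two_values[OF assms(1) True assms(2)] R by (fastforce simp: diff_def)
    ultimately show ?L by (simp add: card_Un_disjoint)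
  qed
  then show ?thesis using True assms by (simp add: graph_interval_def graph_dist_eq)
qed (simp add: graph_interval_def)

theorem median: "median_graph V E"
  unfolding median_graph_def
proof (intro conjI ballI)
  have "irrefl E" using edge_coordinate by (fastforce simp: irrefl_def)
  moreover have "(u, v) \<in> E\<^sup>*" if "u \<in> V" "v \<in> V" for u v
    using walk_exists[OF that] by (rule relpow_imp_rtrancl)
  ultimately show "connected_graph V E"
    using nonempty edge_vertices edge_sym
    by (auto simp: connected_graph_def simple_graph_def intro: symI)
next
  fix u v w assume V: "u \<in> V" "v \<in> V" "w \<in> V"
  let ?I = "graph_interval V E u v \<inter> graph_interval V E u w \<inter> graph_interval V E v w"
  have mem: "x \<in> ?I \<longleftrightarrow> x \<in> V \<and> (\<forall>k<n. (f u k = f v k \<longrightarrow> f x k = f u k) \<and>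
      (f u k = f w k \<longrightarrow> f x k = f u k) \<and> (f v k = f w k \<longrightarrow> f x k = f v k))" for x
    using V by (auto simp: mem_graph_interval)
  from majority[OF V] obtain x where x: "x \<in> ?I" unfolding mem by blast
  moreover have "y = x" if y: "y \<in> ?I" for y
  proof (rule coordinates_inj)
    show "y \<in> V" "x \<in> V" using x y mem by blast+
    fix k assume "k < n"
    then show "f y k = f x k" using two_values[OF V, of k] x y unfolding mem by metis
  qed
  ultimately have "?I = {x}" by blast
  then show "card ?I = 1" by simp
qed

end

section \<open>The letters exchanged by the moves at a fixed shadow\<close>

definition active :: "('a \<Rightarrow> 'a \<Rightarrow> bool) \<Rightarrow> nat \<Rightarrow> 'a list \<Rightarrow> bool" where
  "active E k w \<longleftrightarrow> w ! (2*k) = w ! (2*k + 2) \<and> E (w ! (2*k)) (w ! (2*k + 1))"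

definition braid_flip :: "nat \<Rightarrow> 'a list \<Rightarrow> 'a list" where
  "braid_flip k w = w[2*k := w ! (2*k + 1), 2*k + 1 := w ! (2*k), 2*k + 2 := w ! (2*k + 1)]"

definition pair_at :: "nat \<Rightarrow> 'a list \<Rightarrow> 'a set" where
  "pair_at k w = {w ! (2*k), w ! (2*k + 1)}"

text \<open>
  The combinatorics of the braid class of a link, with \<open>E s t\<close> standing for \<open>m s t = 3\<close>. The group
  enters only through \<open>no_repeat\<close> and through the fact that moves stay in the class.
\<close>

locale link_class =
  fixes E :: "'a \<Rightarrow> 'a \<Rightarrow> bool" and r :: nat and C :: "'a list set"
  assumes E_sym: "E a b \<Longrightarrow> E b a"
    and triangle_free: "\<lbrakk>E a b; E b c; E c a\<rbrakk> \<Longrightarrow> False"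
    and nonempty: "C \<noteq> {}"
    and length_word: "w \<in> C \<Longrightarrow> length w = 2*r + 1"
    and flip_closed: "\<lbrakk>w \<in> C; k < r; active E k w\<rbrakk> \<Longrightarrow> braid_flip k w \<in> C"
    and flip_connected: "\<lbrakk>u \<in> C; v \<in> C\<rbrakk>
      \<Longrightarrow> (u, v) \<in> {(w, braid_flip k w) |w k. w \<in> C \<and> k < r \<and> active E k w}\<^sup>*"
    and active_somewhere: "k < r \<Longrightarrow> \<exists>w\<in>C. active E k w"
    and no_odd_shadow: "\<lbrakk>w \<in> C; Suc k < r; w ! (2*k + 1) = w ! (2*k + 3)\<rbrakk>
      \<Longrightarrow> \<not> E (w ! (2*k + 1)) (w ! (2*k + 2))"
    and no_repeat: "\<lbrakk>w \<in> C; i < 2*r\<rbrakk> \<Longrightarrow> w ! i \<noteq> w ! Suc i"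
begin

lemma flip_nth:
  assumes "w \<in> C" "k < r" "i < 2*r + 1"
  shows "braid_flip k w ! i = (if i = 2*k + 1 then w ! (2*k)
           else if i = 2*k \<or> i = 2*k + 2 then w ! (2*k + 1) else w ! i)"
  using assms length_word[of w] by (auto simp: braid_flip_def nth_list_update)

lemma flip_induct [consumes 2, case_names refl step]:
  assumes "u \<in> C" "v \<in> C" "Q u"
    and "\<And>w k. \<lbrakk>w \<in> C; Q w; k < r; active E k w\<rbrakk> \<Longrightarrow> Q (braid_flip k w)"
  shows "Q v"
  using flip_connected[OF assms(1,2)]
  by (induction rule: rtrancl_induct) (auto intro: assms)

lemma E_irrefl: "\<not> E a a"
  using triangle_free by blast

text \<open>
  Triangle-freeness makes all moves at \<open>k\<close> exchange the same two letters. Let \<open>p\<close> be a flank of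
  the centre \<open>2*k + 1\<close>, and let the other moves that affect \<open>p\<close> all exchange the two letters in \<open>Q\<close>
  (with \<open>Q = {}\<close> if there are none). Compared with the word \<open>u\<close>, the centre \<open>c\<close> stays in the pair of \<open>u\<close>, and if
  \<open>y\<close> is the other letter of this pair, then \<open>p\<close> carries \<open>y\<close>, or a neighbouring move has replaced \<open>y\<close> by
  the other letter of \<open>Q\<close>. In the second case \<open>k\<close> cannot be active, since \<open>y\<close>, \<open>c\<close> and the letter at \<open>p\<close>
  would be pairwise related by \<open>E\<close>.
\<close>

lemma flank_invariant:
  assumes k: "k < r" and p: "p = 2*k \<or> p = 2*k + 2"
    and neighbour: "\<And>w j. \<lbrakk>w \<in> C; j < r; j \<noteq> k; p = 2*j \<or> p = 2*j + 2; active E j w\<rbrakk>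
      \<Longrightarrow> pair_at j w = Q"
    and Q: "\<And>x y. Q = {x, y} \<Longrightarrow> E x y"
    and u: "u \<in> C" "active E k u" and v: "v \<in> C"
  shows "\<exists>y. pair_at k u = {v ! (2*k + 1), y} \<and> (v ! p = y \<or> Q = {v ! p, y})" (is "?J v")
    and "active E k v \<Longrightarrow> pair_at k v = pair_at k u"
proof -
  let ?P = "pair_at k u"
  have PE: "E x y" if "?P = {x, y}" for x y
    using that u(2) E_sym by (auto simp: pair_at_def active_def doubleton_eq_iff)
  have flank: "v ! p = y"
    if "?P = {v ! (2*k + 1), y}" "v ! p = y \<or> Q = {v ! p, y}" "active E k v" for v y
  proof (rule ccontr)
    assume "v ! p \<noteq> y"
    then have "E (v ! p) y" using that(2) Q by blast
    moreover have "E (v ! (2*k + 1)) y" using that(1) PE by blast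
    moreover have "E (v ! p) (v ! (2*k + 1))" using that(3) p by (auto simp: active_def)
    ultimately show False using triangle_free E_sym by blast
  qed
  show J: "?J v"
    using u(1) v
  proof (induction rule: flip_induct)
    case refl
    then show ?case using u(2) p by (auto simp: pair_at_def active_def intro!: exI[of _ "u ! p"])
  next
    case (step w j)
    note j = step.hyps
    from step.IH obtain y where y: "?P = {w ! (2*k + 1), y}" "w ! p = y \<or> Q = {w ! p, y}" by blast
    have p_lt: "p < 2*r + 1" using k p by auto
    have centre: "braid_flip j w ! (2*k + 1) = (if j = k then w ! (2*k) else w ! (2*k + 1))"
      using j k by (subst flip_nth) auto
    consider "j = k" | "j \<noteq> k" "p = 2*j \<or> p = 2*j + 2" | "p \<noteq> 2*j" "p \<noteq> 2*j + 2" by blast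
    then show ?case
    proof cases
      case 1
      have "active E k w" using j(3) 1 by simp
      then have "w ! (2*k) = y" using flank[OF y] p by (auto simp: active_def)
      moreover have "braid_flip j w ! p = w ! (2*k + 1)"
        using j p_lt p 1 by (subst flip_nth) auto
      ultimately show ?thesis using centre 1 y by auto
    next
      case 2
      then have "Q = {w ! p, w ! (2*j + 1)}"
        using neighbour[OF j(1,2) 2 j(3)] j(3) by (auto simp: pair_at_def active_def)
      moreover have "braid_flip j w ! p = w ! (2*j + 1)"
        using j p_lt 2 by (subst flip_nth) auto
      ultimately show ?thesis using centre 2 y by (auto simp: doubleton_eq_iff)
    next
      case 3
      moreover have "p \<noteq> 2*j + 1" using p by presburger
      ultimately have "braid_flip j w ! p = w ! p"
        using j p_lt by (subst flip_nth) auto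
      moreover have "j \<noteq> k" using 3 p by auto
      ultimately show ?thesis using centre y by auto
    qed
  qed
  assume a: "active E k v"
  from J obtain y where y: "?P = {v ! (2*k + 1), y}" "v ! p = y \<or> Q = {v ! p, y}" by blast
  have "v ! (2*k) = y" using flank[OF y a] a p by (auto simp: active_def)
  then show "pair_at k v = ?P" using y(1) by (simp add: pair_at_def insert_commute)
qed

text \<open>The palette of \<open>r\<close> is empty, so that the flank at the right end of the word fits the case
  \<open>Q = {}\<close> of \<open>flank_invariant\<close>.\<close>

definition palette :: "nat \<Rightarrow> 'a set" where
  "palette k = (if k < r then pair_at k (SOME w. w \<in> C \<and> active E k w) else {})"

lemma palette_witness:
  assumes "k < r"
  obtains w where "w \<in> C" "active E k w" "palette k = pair_at k w"
  using someI_ex[of "\<lambda>w. w \<in> C \<and> active E k w"] active_somewhere[OF assms] assms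
  by (auto simp: palette_def)

lemma palette_edge: "palette k = {x, y} \<Longrightarrow> E x y"
proof (cases "k < r")
  case True
  assume "palette k = {x, y}"
  moreover obtain w where "active E k w" "palette k = pair_at k w"
    using palette_witness[OF True] by blast
  ultimately show ?thesis using E_sym by (auto simp: pair_at_def active_def doubleton_eq_iff)
qed (auto simp: palette_def)

lemma palette_two:
  assumes "k < r" "x \<in> palette k" "y \<in> palette k" "x \<noteq> y"
  shows "palette k = {x, y}"
proof -
  obtain w where "palette k = pair_at k w" using palette_witness[OF assms(1)] by blast
  then obtain a b where ab: "palette k = {a, b}" by (simp add: pair_at_def)
  then have "x = a \<and> y = b \<or> x = b \<and> y = a" using assms(2-4) by auto
  then show ?thesis using ab by (auto simp: doubleton_eq_iff)
qed

text \<open>The left flank of \<open>k\<close> is affected only by moves at \<open>k - 1\<close> and \<open>k\<close>, so induction on \<open>k\<close> provides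
  the hypothesis of \<open>flank_invariant\<close>.\<close>

lemma pair_at_active:
  assumes "k < r" "w \<in> C" "active E k w"
  shows "pair_at k w = palette k"
  using assms
proof (induction k arbitrary: w)
  case 0
  obtain u where "u \<in> C" "active E 0 u" "palette 0 = pair_at 0 u"
    using palette_witness[OF 0(1)] by blast
  then show ?case using flank_invariant(2)[of 0 0 "{}" u w] 0 by auto
next
  case (Suc k)
  obtain u where "u \<in> C" "active E (Suc k) u" "palette (Suc k) = pair_at (Suc k) u"
    using palette_witness[OF Suc.prems(1)] by blast
  then show ?case
    using flank_invariant(2)[of "Suc k" "2 * Suc k" "palette k" u w] Suc palette_edge by auto
qed

text \<open>With the palettes available on both sides, \<open>flank_invariant\<close> applies to both flanks.\<close>

lemma centre_and_flanks:
  assumes k: "k < r" and w: "w \<in> C"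
  obtains y where "palette k = {w ! (2*k + 1), y}"
    "w ! (2*k) = y \<or> (\<exists>j. k = Suc j \<and> palette j = {w ! (2*k), y})"
    "w ! (2*k + 2) = y \<or> (Suc k < r \<and> palette (Suc k) = {w ! (2*k + 2), y})"
proof -
  obtain u where u: "u \<in> C" "active E k u" "palette k = pair_at k u"
    using palette_witness[OF k] by blast
  have right: "\<exists>y. palette k = {w ! (2*k + 1), y} \<and>
      (w ! (2*k + 2) = y \<or> palette (Suc k) = {w ! (2*k + 2), y})"
    unfolding u(3)
  proof (rule flank_invariant(1)[OF k _ _ palette_edge u(1,2) w])
    fix w j assume w: "w \<in> C" "j < r" "j \<noteq> k" "2*k + 2 = 2*j \<or> 2*k + 2 = 2*j + 2" "active E j w"
    from w(3,4) have "j = Suc k" by presburger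
    then show "pair_at j w = palette (Suc k)" using w pair_at_active by blast
  qed auto
  have left: "\<exists>y. palette k = {w ! (2*k + 1), y} \<and>
      (w ! (2*k) = y \<or> (if k = 0 then {} else palette (k - 1)) = {w ! (2*k), y})"
    unfolding u(3)
  proof (rule flank_invariant(1)[OF k _ _ _ u(1,2) w])
    fix w j assume w: "w \<in> C" "j < r" "j \<noteq> k" "2*k = 2*j \<or> 2*k = 2*j + 2" "active E j w"
    from w(3,4) have "j = k - 1" "k \<noteq> 0" by presburger+
    then show "pair_at j w = (if k = 0 then {} else palette (k - 1))" using w pair_at_active by simp
  qed (auto intro: palette_edge split: if_splits)
  from right obtain y where y: "palette k = {w ! (2*k + 1), y}"
    "w ! (2*k + 2) = y \<or> palette (Suc k) = {w ! (2*k + 2), y}" by blast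
  from left obtain y' where y': "palette k = {w ! (2*k + 1), y'}"
    "w ! (2*k) = y' \<or> (if k = 0 then {} else palette (k - 1)) = {w ! (2*k), y'}" by blast
  have "y' = y" using y(1) y'(1) by (auto simp: doubleton_eq_iff)
  show ?thesis
  proof (rule that[OF y(1)])
    show "w ! (2*k) = y \<or> (\<exists>j. k = Suc j \<and> palette j = {w ! (2*k), y})"
      using y'(2) \<open>y' = y\<close> by (cases k) auto
    show "w ! (2*k + 2) = y \<or> (Suc k < r \<and> palette (Suc k) = {w ! (2*k + 2), y})"
      using y(2) by (auto simp: palette_def split: if_splits)
  qed
qed

text \<open>
  Let \<open>a\<close>, \<open>x\<close>, \<open>b\<close> be two consecutive centres and the flank between them. By
  \<open>centre_and_flanks\<close>, \<open>x = c\<close> or the palette of \<open>k + 1\<close> is \<open>{x, c}\<close>, and likewise \<open>x = d\<close> or the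
  palette of \<open>k\<close> is \<open>{x, d}\<close>. If both second alternatives held without the first, then
  \<open>x = a\<close>, a repeated letter. In the remaining cases \<open>a = b\<close> would give a shadow centred at \<open>x\<close> or a
  repeated letter.
\<close>

lemma flank_between:
  assumes k: "Suc k < r" and w: "w \<in> C"
    and P: "palette k = {w ! (2*k + 1), c}" and Q: "palette (Suc k) = {w ! (2*k + 3), d}"
  shows "w ! (2*k + 1) \<noteq> w ! (2*k + 3)"
    and "palette k \<noteq> palette (Suc k)"
    and "c \<noteq> w ! (2*k + 3) \<Longrightarrow> w ! (2*k + 2) = c"
    and "d \<noteq> w ! (2*k + 1) \<Longrightarrow> w ! (2*k + 2) = d"
proof -
  define x where "x = w ! (2*k + 2)"
  define a where "a = w ! (2*k + 1)"
  define b where "b = w ! (2*k + 3)"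
  have ne: "a \<noteq> x" "x \<noteq> b"
    using no_repeat[OF w, of "2*k + 1"] no_repeat[OF w, of "2*k + 2"] k
    by (auto simp: a_def b_def x_def eval_nat_numeral)
  obtain y where y: "palette k = {w ! (2*k + 1), y}"
    "w ! (2*k + 2) = y \<or> (Suc k < r \<and> palette (Suc k) = {w ! (2*k + 2), y})"
    using centre_and_flanks[of k w] k w by (metis Suc_lessD)
  moreover have "y = c" using y(1) P by (auto simp: doubleton_eq_iff)
  ultimately have R: "x = c \<or> palette (Suc k) = {x, c}" by (auto simp: x_def)
  obtain z where "palette (Suc k) = {w ! (2 * Suc k + 1), z}"
    "w ! (2 * Suc k) = z \<or> (\<exists>j. Suc k = Suc j \<and> palette j = {w ! (2 * Suc k), z})"
    by (rule centre_and_flanks[OF k w], rule that)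
  then have z: "palette (Suc k) = {w ! (2*k + 3), z}"
    "w ! (2*k + 2) = z \<or> palette k = {w ! (2*k + 2), z}"
    by (simp_all add: eval_nat_numeral)
  moreover have "z = d" using z(1) Q by (auto simp: doubleton_eq_iff)
  ultimately have L: "x = d \<or> palette k = {x, d}" by (auto simp: x_def)
  have no: "a = b \<Longrightarrow> \<not> E a x"
    using no_odd_shadow[OF w k] by (simp add: a_def b_def x_def)
  have E: "E a c" "E b d" using P Q palette_edge by (auto simp: a_def b_def)
  show "w ! (2*k + 1) \<noteq> w ! (2*k + 3)" "palette k \<noteq> palette (Suc k)"
    "c \<noteq> w ! (2*k + 3) \<Longrightarrow> w ! (2*k + 2) = c" "d \<noteq> w ! (2*k + 1) \<Longrightarrow> w ! (2*k + 2) = d"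
    using R L no E ne P Q E_irrefl unfolding x_def[symmetric] a_def[symmetric] b_def[symmetric]
    by (auto simp: doubleton_eq_iff)
qed

section \<open>Words of the class as proper list colourings of a path\<close>

definition colouring :: "'a list \<Rightarrow> nat \<Rightarrow> 'a" where
  "colouring w k = w ! (2*k + 1)"

definition proper :: "(nat \<Rightarrow> 'a) \<Rightarrow> bool" where
  "proper c \<longleftrightarrow> (\<forall>k<r. c k \<in> palette k) \<and> (\<forall>k. Suc k < r \<longrightarrow> c k \<noteq> c (Suc k))"

lemma palette_colouring:
  assumes "w \<in> C" "k < r"
  obtains y where "palette k = {colouring w k, y}"
  using centre_and_flanks[OF assms(2,1)] unfolding colouring_def by metis

lemma colouring_Suc: "colouring w (Suc k) = w ! (2*k + 3)"
  by (simp add: colouring_def eval_nat_numeral)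

lemma proper_colouring:
  assumes "w \<in> C"
  shows "proper (colouring w)"
  unfolding proper_def
proof (intro conjI allI impI)
  fix k assume "k < r"
  then show "colouring w k \<in> palette k" using palette_colouring[OF assms] by blast
next
  fix k assume k: "Suc k < r"
  obtain c where c: "palette k = {colouring w k, c}" using palette_colouring[OF assms] k by (metis Suc_lessD)
  obtain d where d: "palette (Suc k) = {colouring w (Suc k), d}" using palette_colouring[OF assms k] .
  show "colouring w k \<noteq> colouring w (Suc k)"
    using flank_between(1)[OF k assms] c d by (simp add: colouring_Suc) (simp add: colouring_def)
qed

lemma palette_Suc_neq:
  assumes k: "Suc k < r"
  shows "palette k \<noteq> palette (Suc k)"
proof -
  obtain w where w: "w \<in> C" using nonempty by blast
  obtain c where c: "palette k = {colouring w k, c}" using palette_colouring[OF w] k by (metis Suc_lessD)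
  obtain d where d: "palette (Suc k) = {colouring w (Suc k), d}" using palette_colouring[OF w k] .
  show ?thesis
    using flank_between(2)[OF k w] c d unfolding colouring_Suc unfolding colouring_def by blast
qed

text \<open>A flank equals the unused palette letter of one of its two centres: otherwise each of these
  letters would be the colour of the opposite centre, and the two palettes would agree.\<close>

lemma colouring_inj:
  assumes u: "u \<in> C" and v: "v \<in> C" and eq: "\<And>k. k < r \<Longrightarrow> colouring u k = colouring v k"
  shows "u = v"
proof (cases "r = 0")
  case True
  then show ?thesis using flip_connected[OF u v] by (auto elim: rtranclE)
next
  case False
  have odd: "u ! (2*k + 1) = v ! (2*k + 1)" if "k < r" for k
    using eq[OF that] by (simp add: colouring_def)
  show ?thesis
  proof (rule nth_equalityI)
    show "length u = length v" using u v length_word by simp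
    fix i assume "i < length u"
    then have i: "i < 2*r + 1" using u length_word by simp
    consider k where "i = 2*k + 1" "k < r" | "i = 0" | k where "i = 2*k + 2" "Suc k < r"
      | k where "i = 2*k + 2" "Suc k = r"
    proof (cases "odd i")
      case True
      then show ?thesis using that(1) i by (auto elim!: oddE)
    next
      case False
      then obtain j where j: "i = 2*j" by blast
      show ?thesis
        using that(2) that(3,4)[of "j - 1"] j i by (cases j) force+
    qed
    then show "u ! i = v ! i"
    proof cases
      case 1
      then show ?thesis using odd by simp
    next
      case 2
      obtain y where "palette 0 = {u ! 1, y}" "u ! 0 = y"
        using centre_and_flanks[of 0 u] u False by auto
      moreover obtain z where "palette 0 = {v ! 1, z}" "v ! 0 = z"
        using centre_and_flanks[of 0 v] v False by auto
      ultimately show ?thesis using odd[of 0] False 2 by (auto simp: doubleton_eq_iff)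
    next
      case (3 k)
      obtain c where c: "palette k = {u ! (2*k + 1), c}"
        using palette_colouring[OF u, of k] 3 by (auto simp: colouring_def)
      obtain d where d: "palette (Suc k) = {u ! (2*k + 3), d}"
        using palette_colouring[OF u 3(2)] unfolding colouring_Suc .
      have k: "u ! (2*k + 1) = v ! (2*k + 1)" "u ! (2*k + 3) = v ! (2*k + 3)"
        using odd[of k] eq[OF 3(2)] 3 by (simp_all add: colouring_Suc)
      have "c \<noteq> u ! (2*k + 3) \<or> d \<noteq> u ! (2*k + 1)"
        using palette_Suc_neq[OF 3(2)] c d by auto
      then show ?thesis
        using flank_between(3,4)[OF 3(2) u c d] flank_between(3,4)[OF 3(2) v c[unfolded k] d[unfolded k]]
        unfolding 3(1) k by metis
    next
      case (4 k)
      obtain y where "palette k = {u ! (2*k + 1), y}" "u ! (2*k + 2) = y"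
        using centre_and_flanks[of k u] u 4 by auto
      moreover obtain z where "palette k = {v ! (2*k + 1), z}" "v ! (2*k + 2) = z"
        using centre_and_flanks[of k v] v 4 by auto
      ultimately show ?thesis using odd[of k] 4 by (auto simp: doubleton_eq_iff)
    qed
  qed
qed

lemma colouring_flip:
  assumes "w \<in> C" "j < r" "k < r"
  shows "colouring (braid_flip j w) k = (if k = j then w ! (2*j) else colouring w k)"
  using assms unfolding colouring_def by (subst flip_nth) auto

text \<open>If neither neighbouring centre carries \<open>y\<close>, then \<open>flank_between\<close> puts \<open>y\<close> on both flanks.\<close>

lemma active_if_recolourable:
  assumes w: "w \<in> C" and k: "k < r" and y: "palette k = {colouring w k, y}"
    and left: "\<And>j. k = Suc j \<Longrightarrow> y \<noteq> colouring w j"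
    and right: "Suc k < r \<Longrightarrow> y \<noteq> colouring w (Suc k)"
  shows "active E k w" and "w ! (2*k) = y"
proof -
  obtain z where z: "palette k = {w ! (2*k + 1), z}"
    "w ! (2*k) = z \<or> (\<exists>j. k = Suc j \<and> palette j = {w ! (2*k), z})"
    "w ! (2*k + 2) = z \<or> (Suc k < r \<and> palette (Suc k) = {w ! (2*k + 2), z})"
    using centre_and_flanks[OF k w] .
  then have "z = y" using y by (auto simp: colouring_def doubleton_eq_iff)
  note z = z[unfolded this]
  show l: "w ! (2*k) = y"
  proof (cases k)
    case 0
    then show ?thesis using z by auto
  next
    case (Suc j)
    then have j: "j < r" "Suc j < r" using k by auto
    obtain c where c: "palette j = {w ! (2*j + 1), c}"
      using palette_colouring[OF w j(1)] by (auto simp: colouring_def)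
    have "palette (Suc j) = {w ! (2*j + 3), y}" using y unfolding Suc colouring_Suc .
    from flank_between(4)[OF j(2) w c this] left[OF Suc] Suc show ?thesis
      by (simp add: colouring_def)
  qed
  have "w ! (2*k + 2) = y"
  proof (cases "Suc k < r")
    case False
    then show ?thesis using z by auto
  next
    case True
    obtain d where d: "palette (Suc k) = {w ! (2*k + 3), d}"
      using palette_colouring[OF w True] unfolding colouring_Suc .
    show ?thesis
      using flank_between(3)[OF True w z(1) d] right[OF True] by (simp add: colouring_Suc)
  qed
  moreover have "E y (w ! (2*k + 1))" using palette_edge[OF z(1)] by (rule E_sym)
  ultimately show "active E k w" using l by (simp add: active_def)
qed

text \<open>
  If recolouring \<open>k\<close> from \<open>a k\<close> to \<open>b k\<close> is obstructed by a neighbour \<open>j\<close>, then \<open>a j = b k\<close>, so \<open>b j\<close>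
  differs from \<open>a j\<close> because \<open>b\<close> is proper. Two neighbours cannot obstruct each other, since their palettes
  would agree. Hence obstructions, once they point to the right, keep pointing to the right, and
  must stop at the end of the path.
\<close>

lemma legal_recolouring:
  assumes a: "proper a" and b: "proper b" and ne: "i < r" "a i \<noteq> b i"
  obtains k where "k < r" "a k \<noteq> b k" "\<And>j. k = Suc j \<Longrightarrow> b k \<noteq> a j"
    "Suc k < r \<Longrightarrow> b k \<noteq> a (Suc k)"
proof -
  define A where "A = {k. k < r \<and> a k \<noteq> b k \<and> (\<forall>j. k = Suc j \<longrightarrow> b k \<noteq> a j)}"
  have fin: "finite A" by (simp add: A_def)
  define l where "l = (LEAST i. i < r \<and> a i \<noteq> b i)"
  have l: "l < r \<and> a l \<noteq> b l" unfolding l_def by (rule LeastI[of _ i]) (use ne in auto)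
  have "b l \<noteq> a j" if "l = Suc j" for j
  proof -
    have "a j = b j" using not_less_Least[of j "\<lambda>i. i < r \<and> a i \<noteq> b i"] that l by (auto simp: l_def)
    then show ?thesis using b l that unfolding proper_def by metis
  qed
  \<comment> \<open>The set \<open>A\<close> consists of the positions to recolour that are not obstructed from the left. It is nonempty
    as it contains the first differing position, and its last element is not obstructed at all.\<close>
  then have "l \<in> A" using l by (auto simp: A_def)
  define k where "k = Max A"
  have "k \<in> A" unfolding k_def by (rule Max_in) (use fin \<open>l \<in> A\<close> in auto)
  then have k: "k < r" "a k \<noteq> b k" "\<And>j. k = Suc j \<Longrightarrow> b k \<noteq> a j" by (auto simp: A_def)
  have "b k \<noteq> a (Suc k)" if s: "Suc k < r"
  proof
    assume eq: "b k = a (Suc k)"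
    have diff: "b (Suc k) \<noteq> a (Suc k)" using b s eq by (metis proper_def)
    have "b (Suc k) \<noteq> a k"
    proof
      assume eq': "b (Suc k) = a k"
      have "palette k = {a k, b k}" using k a b by (intro palette_two) (auto simp: proper_def)
      moreover have "palette (Suc k) = {b (Suc k), a (Suc k)}"
        using s diff a b by (intro palette_two) (auto simp: proper_def)
      ultimately show False using palette_Suc_neq[OF s] eq eq' by simp
    qed
    then have "Suc k \<in> A" using s diff by (auto simp: A_def)
    then have "Suc k \<le> k" unfolding k_def using fin by (rule Max_ge[rotated])
    then show False by simp
  qed
  then show ?thesis using that k by blast
qed

lemma flip_towards:
  assumes w: "w \<in> C" and c: "proper c" and ne: "i < r" "colouring w i \<noteq> c i"
  obtains k where "k < r" "colouring w k \<noteq> c k" "active E k w"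
    "\<And>j. j < r \<Longrightarrow> colouring (braid_flip k w) j = (if j = k then c k else colouring w j)"
proof -
  obtain k where k: "k < r" "colouring w k \<noteq> c k" "\<And>j. k = Suc j \<Longrightarrow> c k \<noteq> colouring w j"
    "Suc k < r \<Longrightarrow> c k \<noteq> colouring w (Suc k)"
    using legal_recolouring[OF proper_colouring[OF w] c ne] by metis
  obtain y where "palette k = {colouring w k, y}" using palette_colouring[OF w k(1)] .
  moreover have "c k \<in> palette k" using c k(1) by (simp add: proper_def)
  ultimately have "palette k = {colouring w k, c k}" using k(2) by auto
  note * = active_if_recolourable[OF w k(1) this k(3,4)]
  show ?thesis
    by (rule that[OF k(1,2) *(1)]) (use colouring_flip[OF w k(1)] *(2) in auto)
qed

lemma proper_realised:
  assumes "proper c" "u \<in> C"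
  shows "\<exists>x\<in>C. \<forall>k<r. colouring x k = c k"
  using assms(2)
proof (induction "card {k. k < r \<and> colouring u k \<noteq> c k}" arbitrary: u rule: less_induct)
  case less
  show ?case
  proof (cases "\<exists>i<r. colouring u i \<noteq> c i")
    case True
    then obtain i where "i < r" "colouring u i \<noteq> c i" by blast
    from flip_towards[OF less.prems assms(1) this] obtain k where
      k: "k < r" "colouring u k \<noteq> c k" "active E k u"
      "\<And>j. j < r \<Longrightarrow> colouring (braid_flip k u) j = (if j = k then c k else colouring u j)"
      by blast
    let ?D = "\<lambda>u. {j. j < r \<and> colouring u j \<noteq> c j}"
    have "k \<in> ?D u" "k \<notin> ?D (braid_flip k u)" using k by simp_all
    moreover have "?D (braid_flip k u) \<subseteq> ?D u" 
    proof
      fix j assume "j \<in> ?D (braid_flip k u)"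
      then show "j \<in> ?D u" using k(4)[of j] by (auto split: if_splits)
    qed
    ultimately have "?D (braid_flip k u) \<subset> ?D u" by blast
    then have "card {j. j < r \<and> colouring (braid_flip k u) j \<noteq> c j}
        < card {j. j < r \<and> colouring u j \<noteq> c j}"
      by (intro psubset_card_mono) auto
    then show ?thesis using less.hyps flip_closed[OF less.prems k(1,3)] by blast
  qed (use less.prems in blast)
qed

text \<open>If the majority colours of two neighbours agreed, then two of the three colourings would have this
  colour at \<open>k\<close> and two would have it at \<open>k + 1\<close>, so one of them would have it at both.\<close>

lemma proper_majority:
  assumes u: "proper u" and v: "proper v" and w: "proper w"
  shows "proper (\<lambda>k. if u k = v k then u k else w k)"
proof -
  have m: "u k = v k \<or> u k = w k \<or> v k = w k" if "k < r" for k
    using palette_two[OF that, of "u k" "v k"] u v w that by (auto simp: proper_def)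
  show ?thesis
    unfolding proper_def
  proof (intro conjI allI impI)
    fix k assume "k < r"
    then show "(if u k = v k then u k else w k) \<in> palette k" using u w by (auto simp: proper_def)
  next
    fix k assume k: "Suc k < r"
    have "u k \<noteq> u (Suc k)" "v k \<noteq> v (Suc k)" "w k \<noteq> w (Suc k)"
      using u v w k by (auto simp: proper_def)
    then show "(if u k = v k then u k else w k) \<noteq> (if u (Suc k) = v (Suc k) then u (Suc k) else w (Suc k))"
      using m[of k] m[OF k] k by (auto split: if_splits)
  qed
qed

lemma flip_flip:
  assumes w: "w \<in> C" and k: "k < r" and a: "active E k w"
  shows "active E k (braid_flip k w)" and "braid_flip k (braid_flip k w) = w"
proof -
  have C: "braid_flip k w \<in> C" using flip_closed[OF assms] .
  show "active E k (braid_flip k w)"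
    using a k E_sym unfolding active_def
    by (subst (1 2 3 4) flip_nth[OF w k]) auto
  show "braid_flip k (braid_flip k w) = w"
  proof (rule nth_equalityI)
    show "length (braid_flip k (braid_flip k w)) = length w" by (simp add: braid_flip_def)
    fix i assume "i < length (braid_flip k (braid_flip k w))"
    then have "i < 2*r + 1" using w length_word by (simp add: braid_flip_def)
    then show "braid_flip k (braid_flip k w) ! i = w ! i"
      using a k by (simp add: flip_nth[OF C k] flip_nth[OF w k] active_def)
  qed
qed

theorem median_flip_graph:
  "median_graph C {(w, braid_flip k w) |w k. w \<in> C \<and> k < r \<and> active E k w}"
proof -
  interpret binary_coordinates C "{(w, braid_flip k w) |w k. w \<in> C \<and> k < r \<and> active E k w}" r colouring
  proof (unfold_locales, goal_cases)
    case 1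
    then show ?case using nonempty .
  next
    case 2
    then show ?case using flip_closed by auto
  next
    case (3 u v)
    then obtain k where k: "u \<in> C" "k < r" "active E k u" "v = braid_flip k u" by blast
    then have "v \<in> C" "active E k v" "u = braid_flip k v"
      using flip_closed flip_flip by simp_all
    then show ?case using k(2) by blast
  next
    case (4 u v)
    then obtain k where k: "u \<in> C" "k < r" "active E k u" "v = braid_flip k u" by blast
    have "colouring u k \<noteq> u ! (2*k)"
      using k(3) E_irrefl by (auto simp: active_def colouring_def)
    then have "{i. i < r \<and> colouring u i \<noteq> colouring v i} = {k}"
      using k colouring_flip[OF k(1,2)] by (auto split: if_splits)
    then show ?case ..
  next
    case (5 u v)
    then show ?case using colouring_inj by blast
  next
    case (6 u v w k)
    have "colouring x k \<in> palette k" if "x \<in> C" for x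
      using proper_colouring[OF that] 6 by (simp add: proper_def)
    then show ?case using palette_two[OF 6(4), of "colouring u k" "colouring v k"] 6(1-3) by fastforce
  next
    case (7 u v)
    then obtain i where i: "i < r" "colouring u i \<noteq> colouring v i" using colouring_inj by blast
    from flip_towards[OF 7(1) proper_colouring[OF 7(2)] i] obtain k where
      "k < r" "colouring u k \<noteq> colouring v k" "active E k u"
      "\<And>j. j < r \<Longrightarrow> colouring (braid_flip k u) j = (if j = k then colouring v k else colouring u j)"
      by blast
    then show ?case using 7(1) by (intro exI[of _ "braid_flip k u"] exI[of _ k]) auto
  next
    case (8 u v w)
    note p = proper_colouring
    from proper_realised[OF proper_majority[OF p[OF 8(1)] p[OF 8(2)] p[OF 8(3)]] 8(1)]
    obtain x where x: "x \<in> C"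
      "\<forall>k<r. colouring x k = (if colouring u k = colouring v k then colouring u k else colouring w k)"
      by blast
    then show ?case by (intro bexI[of _ x]) auto
  qed
  show ?thesis by (rule median)
qed

end

section \<open>Reduced words in Coxeter groups\<close>

context
  fixes S :: "'a set" and m :: "'a \<Rightarrow> 'a \<Rightarrow> enat"
  assumes cox: "coxeter_system S m"
begin

abbreviation rel :: "('a gword \<times> 'a gword) set" where
  "rel \<equiv> pres_rel S (coxeter_relators S m)"

abbreviation letters :: "'a list \<Rightarrow> 'a gword" where
  "letters w \<equiv> map (\<lambda>s. (s, True)) w"

lemma letters_gwords [simp]: "w \<in> lists S \<Longrightarrow> letters w \<in> gwords S"
  by (auto simp: gwords_def)

lemma word_value_eq: "w \<in> lists S \<Longrightarrow> word_value S m w = rel `` {letters w}"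
proof (induction w)
  case Nil
  then show ?case by (simp add: word_value_def coxeter_group_def presented_group_def)
next
  case (Cons s w)
  then have "[(s, True)] \<in> gwords S" "letters w \<in> gwords S" by (auto simp: gwords_def)
  then show ?case
    using Cons presented_group_mult[of "[(s, True)]" S "letters w" "coxeter_relators S m"]
    by (simp add: word_value_def coxeter_group_def generator_def)
qed

lemma word_value_cong: "\<lbrakk>u \<in> lists S; v \<in> lists S; (letters u, letters v) \<in> rel\<rbrakk>
    \<Longrightarrow> word_value S m u = word_value S m v"
  by (simp add: word_value_eq equiv_class_eq[OF equiv_pres_rel])

lemma square_rel:
  assumes "u \<in> lists S" "v \<in> lists S" "s \<in> S"
  shows "(letters (u @ [s, s] @ v), letters (u @ v)) \<in> rel"
proof -
  have "m s s = enat 1" using cox assms(3) by (simp add: coxeter_system_def one_enat_def)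
  then have "\<exists>s' t k. letters [s, s] = concat (replicate k [(s', True), (t, True)]) \<and>
      s' \<in> S \<and> t \<in> S \<and> m s' t = enat k"
    using assms(3) by (intro exI[of _ s] exI[of _ 1]) auto
  then have "letters [s, s] \<in> coxeter_relators S m" unfolding coxeter_relators_def by blast
  then show ?thesis
    using pres_rel.relator[of "letters u" S "letters v" "letters [s, s]" "coxeter_relators S m"] assms
      letters_gwords[of u] letters_gwords[of v] letters_gwords[of "[s, s]"]
    by simp
qed

text \<open>Insert \<open>(st)\<^sup>3\<close> in front of \<open>tst\<close> and cancel the three squares that arise in the middle.\<close>

lemma braid_rel:
  assumes "s \<in> S" "t \<in> S" "m s t = 3"
  shows "(letters [s, t, s], letters [t, s, t]) \<in> rel"
proof -
  have "m s t = enat 3" using assms(3) by (simp add: numeral_eq_enat)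
  then have "letters [s, t, s, t, s, t] \<in> coxeter_relators S m"
    using assms(1,2) unfolding coxeter_relators_def
    by (intro CollectI exI[of _ s] exI[of _ t] exI[of _ 3]) (simp add: numeral_3_eq_3)
  then have 1: "(letters [s, t, s, t, s, t, t, s, t], letters [t, s, t]) \<in> rel"
    using pres_rel.relator[of "[]" S "letters [t, s, t]" "letters [s, t, s, t, s, t]"] assms(1,2)
    by (auto simp: gwords_def)
  have "(letters [s, t, s, t, s, t, t, s, t], letters [s, t, s, t, s, s, t]) \<in> rel"
    using square_rel[of "[s, t, s, t, s]" "[s, t]" t] assms(1,2) by simp
  moreover have "(letters [s, t, s, t, s, s, t], letters [s, t, s, t, t]) \<in> rel"
    using square_rel[of "[s, t, s, t]" "[t]" s] assms(1,2) by simp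
  moreover have "(letters [s, t, s, t, t], letters [s, t, s]) \<in> rel"
    using square_rel[of "[s, t, s]" "[]" t] assms(1,2) by simp
  ultimately have "(letters [s, t, s, t, s, t, t, s, t], letters [s, t, s]) \<in> rel"
    by (blast intro: pres_rel.trans)
  then show ?thesis using 1 by (blast intro: pres_rel.trans pres_rel.sym)
qed

lemma reduced_no_repeat:
  assumes w: "reduced S m w" and i: "Suc i < length w"
  shows "w ! i \<noteq> w ! Suc i"
proof
  assume eq: "w ! i = w ! Suc i"
  let ?u = "take i w" and ?v = "drop (Suc (Suc i)) w"
  have split: "w = ?u @ [w ! i, w ! i] @ ?v"
    using i eq by (metis Cons_nth_drop_Suc Suc_lessD append_Cons append_Nil id_take_nth_drop)
  have "w \<in> lists S" using w by (simp add: reduced_def)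
  then have S: "?u \<in> lists S" "?v \<in> lists S" "w ! i \<in> S"
    using i by (auto dest: in_set_takeD in_set_dropD)
  have "word_value S m w = word_value S m (?u @ ?v)"
    using \<open>w \<in> lists S\<close> S square_rel[OF S] unfolding split[symmetric]
    by (intro word_value_cong) auto
  moreover have "?u @ ?v \<in> lists S" using S by simp
  ultimately have "length w \<le> length (?u @ ?v)" using w unfolding reduced_def by metis
  then show False using i by simp
qed

lemma m_eq_3:
  assumes "s \<in> S" "t \<in> S" "m s t = 3"
  shows "s \<noteq> t" "m t s = 3"
proof -
  have "m s s = 1" using cox assms by (simp add: coxeter_system_def)
  moreover have "(1::enat) \<noteq> 3" by (simp add: one_enat_def numeral_eq_enat)
  ultimately show "s \<noteq> t" using assms by metis
  then show "m t s = 3" using cox assms by (auto simp: coxeter_system_def)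
qed

lemma reduced_braid_move:
  assumes "reduced S m \<beta>" "(\<beta>, \<gamma>) \<in> braid_moves S m"
  shows "reduced S m \<gamma>" and "length \<gamma> = length \<beta>"
proof -
  obtain u v s t where *: "\<beta> = u @ [s, t, s] @ v" "\<gamma> = u @ [t, s, t] @ v" "s \<in> S" "t \<in> S" "m s t = 3"
    using assms(2) by (auto simp: braid_moves_def)
  show len: "length \<gamma> = length \<beta>" using * by simp
  have \<beta>: "\<beta> \<in> lists S" using assms(1) by (simp add: reduced_def)
  then have \<gamma>: "\<gamma> \<in> lists S" and uv: "u \<in> lists S" "v \<in> lists S" using * by auto
  have "(letters \<beta>, letters \<gamma>) \<in> rel"
    using pres_rel_context[OF braid_rel[OF *(3-5)], of "letters u" "letters v"] * uv by simp
  then have "word_value S m \<beta> = word_value S m \<gamma>" using \<beta> \<gamma> word_value_cong by blast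
  then show "reduced S m \<gamma>" using assms(1) \<gamma> len by (simp add: reduced_def)
qed

lemma sym_braid_moves: "sym (braid_moves S m)"
  unfolding braid_moves_def sym_def using m_eq_3 by blast

lemma braid_class_length: "reduced S m \<alpha> \<Longrightarrow> \<beta> \<in> braid_class S m \<alpha> \<Longrightarrow> length \<beta> = length \<alpha>"
proof -
  assume "reduced S m \<alpha>" "\<beta> \<in> braid_class S m \<alpha>"
  then have "(\<alpha>, \<beta>) \<in> (braid_moves S m)\<^sup>*" by (simp add: braid_class_def)
  then have "reduced S m \<beta> \<and> length \<beta> = length \<alpha>"
    using \<open>reduced S m \<alpha>\<close>
    by (induction rule: rtrancl_induct) (auto simp: reduced_braid_move)
  then show ?thesis ..
qed

lemma braid_class_closed:
  "\<lbrakk>\<beta> \<in> braid_class S m \<alpha>; (\<beta>, \<gamma>) \<in> braid_moves S m\<rbrakk> \<Longrightarrow> \<gamma> \<in> braid_class S m \<alpha>"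
  unfolding braid_class_def using reduced_braid_move by (auto intro: rtrancl_into_rtrancl)

lemma sym_braid_graph_edges: "sym (braid_graph_edges S m \<alpha>)"
  using sym_braid_moves by (auto simp: braid_graph_edges_def sym_def)

lemma braid_class_connected:
  assumes "reduced S m \<alpha>" "\<beta> \<in> braid_class S m \<alpha>" "\<gamma> \<in> braid_class S m \<alpha>"
  shows "(\<beta>, \<gamma>) \<in> (braid_graph_edges S m \<alpha>)\<^sup>*"
proof -
  have from_\<alpha>: "(\<alpha>, \<delta>) \<in> (braid_graph_edges S m \<alpha>)\<^sup>*" if "\<delta> \<in> braid_class S m \<alpha>" for \<delta>
  proof -
    have "(\<alpha>, \<delta>) \<in> (braid_moves S m)\<^sup>*" using that by (simp add: braid_class_def)
    then have "\<delta> \<in> braid_class S m \<alpha> \<and> (\<alpha>, \<delta>) \<in> (braid_graph_edges S m \<alpha>)\<^sup>*"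
    proof (induction rule: rtrancl_induct)
      case base
      then show ?case using assms(1) by (simp add: braid_class_def)
    next
      case (step x y)
      then have "(x, y) \<in> braid_graph_edges S m \<alpha>"
        using braid_class_closed by (auto simp: braid_graph_edges_def)
      then show ?case using step by (auto intro: rtrancl_into_rtrancl simp: braid_graph_edges_def)
    qed
    then show ?thesis ..
  qed
  have "(\<beta>, \<alpha>) \<in> (braid_graph_edges S m \<alpha>)\<^sup>*"
    using from_\<alpha>[OF assms(2)] sym_rtrancl[OF sym_braid_graph_edges] by (auto dest: symD)
  then show ?thesis using from_\<alpha>[OF assms(3)] by (rule rtrancl_trans)
qed

section \<open>Braid moves and shadows by position\<close>

lemma braid_moves_nth:
  "(\<beta>, \<gamma>) \<in> braid_moves S m \<longleftrightarrow>
     (\<exists>i. i + 2 < length \<beta> \<and> \<beta> ! i = \<beta> ! (i + 2) \<and> \<beta> ! i \<in> S \<and> \<beta> ! (i + 1) \<in> S \<and>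
          m (\<beta> ! i) (\<beta> ! (i + 1)) = 3 \<and>
          \<gamma> = \<beta>[i := \<beta> ! (i + 1), i + 1 := \<beta> ! i, i + 2 := \<beta> ! (i + 1)])" (is "_ \<longleftrightarrow> ?R")
proof
  assume "(\<beta>, \<gamma>) \<in> braid_moves S m"
  then obtain u v s t where *: "\<beta> = u @ [s, t, s] @ v" "\<gamma> = u @ [t, s, t] @ v" "s \<in> S" "t \<in> S" "m s t = 3"
    by (auto simp: braid_moves_def)
  then show ?R
    by (intro exI[of _ "length u"]) (simp add: nth_append list_update_append)
next
  assume ?R
  then obtain i where i: "i + 2 < length \<beta>" "\<beta> ! i = \<beta> ! (i + 2)" "\<beta> ! i \<in> S" "\<beta> ! (i + 1) \<in> S"
    "m (\<beta> ! i) (\<beta> ! (i + 1)) = 3"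
    "\<gamma> = \<beta>[i := \<beta> ! (i + 1), i + 1 := \<beta> ! i, i + 2 := \<beta> ! (i + 1)]" by blast
  define u v s t where "u = take i \<beta>" and "v = drop (i + 3) \<beta>" and "s = \<beta> ! i" and "t = \<beta> ! (i + 1)"
  have "drop i \<beta> = [s, t, s] @ v"
    using i(1,2) Cons_nth_drop_Suc[of i \<beta>] Cons_nth_drop_Suc[of "i + 1" \<beta>]
      Cons_nth_drop_Suc[of "i + 2" \<beta>]
    by (simp add: s_def t_def v_def eval_nat_numeral)
  then have \<beta>: "\<beta> = u @ [s, t, s] @ v" by (metis append_take_drop_id u_def)
  have u: "length u = i" using i(1) by (simp add: u_def)
  have "\<gamma> = (u @ [s, t, s] @ v)[i := t, i + 1 := s, i + 2 := t]"
    using i(6) unfolding s_def[symmetric] t_def[symmetric] unfolding \<beta> .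
  also have "\<dots> = u @ [t, s, t] @ v" using u by (auto simp: list_update_append)
  finally show "(\<beta>, \<gamma>) \<in> braid_moves S m"
    using \<beta> i(3-5) unfolding s_def[symmetric] t_def[symmetric] braid_moves_def by blast
qed

end

lemma triple_eq_iff: "{a, a + 1, a + 2} = {b, b + 1, b + 2} \<longleftrightarrow> a = b" for a b :: nat
proof
  assume "{a, a + 1, a + 2} = {b, b + 1, b + 2}"
  then have "Min {a, a + 1, a + 2} = Min {b, b + 1, b + 2}" by (rule arg_cong)
  then show "a = b" by simp
qed (rule arg_cong)

text \<open>Shadows are counted from \<open>1\<close>, so the letters at indices \<open>i\<close>, \<open>i + 1\<close>, \<open>i + 2\<close> form the shadow
  \<open>{i + 1, i + 2, i + 3}\<close>.\<close>

lemma mem_braid_shadows: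
  "{i + 1, i + 2, i + 3} \<in> braid_shadows m w \<longleftrightarrow>
     i + 2 < length w \<and> w ! i = w ! (i + 2) \<and> m (w ! i) (w ! (i + 1)) = 3" (is "?L \<longleftrightarrow> ?R")
proof
  assume ?L
  then obtain j where j: "{i + 1, i + 2, i + 3} = {j - 1, j, j + 1}" "2 \<le> j" "j + 1 \<le> length w"
    and "\<exists>s t. w ! (j - 2) = s \<and> w ! (j - 1) = t \<and> w ! j = s \<and> m s t = 3"
    unfolding braid_shadows_def by (elim CollectE exE conjE, intro that) blast+
  then have w: "w ! (j - 2) = w ! j" "m (w ! (j - 2)) (w ! (j - 1)) = 3" by simp_all
  from j(2) obtain l where l: "j = l + 2" by (metis le_add_diff_inverse2)
  have "{i + 1, (i + 1) + 1, (i + 1) + 2} = {l + 1, (l + 1) + 1, (l + 1) + 2}"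
    using j(1) by (simp add: l eval_nat_numeral)
  then have "i = l" unfolding triple_eq_iff by simp
  then show ?R using j(3) w l by simp
next
  assume ?R
  then show ?L
    unfolding braid_shadows_def
    by (intro CollectI exI[of _ "i + 2"]) (auto simp: eval_nat_numeral)
qed

text \<open>Both alternatives in the definition of a link follow this pattern: a word of length \<open>1\<close> has
  no shadows.\<close>

lemma link_shadows:
  assumes "coxeter_system S m" "link S m \<alpha>"
  shows "odd (length \<alpha>)"
    and "{i + 1, i + 2, i + 3} \<in> class_shadows S m \<alpha> \<longleftrightarrow> even i \<and> i + 2 < length \<alpha>"
proof -
  have red: "reduced S m \<alpha>" using assms(2) by (simp add: link_def)
  show "odd (length \<alpha>)" using assms(2) by (auto simp: link_def)
  have len: "length \<beta> = length \<alpha>" if "\<beta> \<in> braid_class S m \<alpha>" for \<beta>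
    using braid_class_length[OF assms(1) red that] .
  show "{i + 1, i + 2, i + 3} \<in> class_shadows S m \<alpha> \<longleftrightarrow> even i \<and> i + 2 < length \<alpha>"
  proof (cases "length \<alpha> = 1")
    case True
    then show ?thesis using len unfolding class_shadows_def UN_iff mem_braid_shadows by auto
  next
    case False
    then have cs: "class_shadows S m \<alpha> = {{2*k - 1, 2*k, 2*k + 1} | k. 1 \<le> k \<and> 2*k + 1 \<le> length \<alpha>}"
      using assms(2) by (auto simp: link_def)
    show ?thesis
    proof
      assume "{i + 1, i + 2, i + 3} \<in> class_shadows S m \<alpha>"
      then obtain k where k: "{i + 1, i + 2, i + 3} = {2*k - 1, 2*k, 2*k + 1}" "1 \<le> k"
        "2*k + 1 \<le> length \<alpha>" unfolding cs by (elim CollectE exE conjE, intro that)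
      from k(2) obtain l where l: "k = l + 1" by (metis le_add_diff_inverse2)
      have "{i + 1, (i + 1) + 1, (i + 1) + 2} = {2*l + 1, (2*l + 1) + 1, (2*l + 1) + 2}"
        using k(1) by (simp add: l eval_nat_numeral)
      then have "i = 2*l" unfolding triple_eq_iff by simp
      then show "even i \<and> i + 2 < length \<alpha>" using k(3) l by simp
    next
      assume i: "even i \<and> i + 2 < length \<alpha>"
      then obtain l where "i = 2*l" by blast
      then show "{i + 1, i + 2, i + 3} \<in> class_shadows S m \<alpha>"
        unfolding cs using i by (intro CollectI exI[of _ "l + 1"]) (simp add: eval_nat_numeral)
    qed
  qed
qed

section \<open>Braid graphs of links\<close>

theorem theorem8p1:
  fixes S :: "'a set" and m :: "'a \<Rightarrow> 'a \<Rightarrow> enat" and \<alpha> :: "'a list"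
  assumes "coxeter_system S m"
    and "type_Lambda S m"
    and "link S m \<alpha>"
  shows "median_graph (braid_class S m \<alpha>) (braid_graph_edges S m \<alpha>)"
proof -
  note cox = assms(1)
  define E where "E s t \<longleftrightarrow> s \<in> S \<and> t \<in> S \<and> m s t = 3" for s t
  define C where "C = braid_class S m \<alpha>"
  define r where "r = length \<alpha> div 2"
  have red: "reduced S m \<alpha>" using assms(3) by (simp add: link_def)
  have len_\<alpha>: "length \<alpha> = 2*r + 1" using link_shadows(1)[OF cox assms(3)] by (auto simp: r_def elim: oddE)
  have len: "length w = 2*r + 1" if "w \<in> C" for w
    using braid_class_length[OF cox red] that len_\<alpha> by (simp add: C_def)
  have red_C: "reduced S m w" if "w \<in> C" for w using that by (simp add: C_def braid_class_def)
  have letter: "w ! i \<in> S" if "w \<in> C" "i < 2*r + 1" for w i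
    using red_C[OF that(1)] len[OF that(1)] that(2) by (auto simp: reduced_def)
  have even_shadow: "even i"
    if "w \<in> C" "i + 2 < 2*r + 1" "w ! i = w ! (i + 2)" "m (w ! i) (w ! (i + 1)) = 3" for w i
  proof -
    have "{i + 1, i + 2, i + 3} \<in> class_shadows S m \<alpha>"
      unfolding class_shadows_def UN_iff mem_braid_shadows
      by (rule bexI[of _ w]) (use that len in \<open>auto simp: C_def\<close>)
    then show ?thesis using link_shadows(2)[OF cox assms(3)] by blast
  qed
  have flip_move: "(w, braid_flip k w) \<in> braid_moves S m" if "w \<in> C" "k < r" "active E k w" for w k
    using that len[OF that(1)] unfolding braid_moves_nth[OF cox]
    by (intro exI[of _ "2*k"]) (auto simp: active_def E_def braid_flip_def)
  have move_flip: "\<exists>k<r. active E k w \<and> v = braid_flip k w"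
    if w: "w \<in> C" and move: "(w, v) \<in> braid_moves S m" for w v
  proof -
    from move obtain i where i: "i + 2 < 2*r + 1" "w ! i = w ! (i + 2)" "w ! i \<in> S" "w ! (i + 1) \<in> S"
      "m (w ! i) (w ! (i + 1)) = 3" "v = w[i := w ! (i + 1), i + 1 := w ! i, i + 2 := w ! (i + 1)]"
      unfolding braid_moves_nth[OF cox] len[OF w] by blast
    obtain k where k: "i = 2*k" using even_shadow[OF w i(1,2,5)] by blast
    show ?thesis
      using i unfolding k by (intro exI[of _ k]) (auto simp: active_def E_def braid_flip_def)
  qed
  have edges: "braid_graph_edges S m \<alpha> = {(w, braid_flip k w) |w k. w \<in> C \<and> k < r \<and> active E k w}"
  proof (intro equalityI subrelI)
    fix w v assume "(w, v) \<in> braid_graph_edges S m \<alpha>"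
    then have "w \<in> C" "(w, v) \<in> braid_moves S m" by (auto simp: braid_graph_edges_def C_def)
    then show "(w, v) \<in> {(w, braid_flip k w) |w k. w \<in> C \<and> k < r \<and> active E k w}"
      using move_flip by blast
  next
    fix w v assume "(w, v) \<in> {(w, braid_flip k w) |w k. w \<in> C \<and> k < r \<and> active E k w}"
    then have "w \<in> C" "(w, v) \<in> braid_moves S m" using flip_move by auto
    then show "(w, v) \<in> braid_graph_edges S m \<alpha>"
      using braid_class_closed[OF cox] by (auto simp: braid_graph_edges_def C_def)
  qed
  interpret link_class E r C
  proof (unfold_locales, goal_cases)
    case (1 a b)
    then show ?case using m_eq_3[OF cox] by (simp add: E_def)
  next
    case (2 a b c)
    have "coxeter_edge S m s t" if "E s t" for s t
      using that m_eq_3[OF cox, of s t] by (auto simp: E_def coxeter_edge_def)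
    then show ?case using 2 assms(2) unfolding type_Lambda_def by blast
  next
    case 3
    have "\<alpha> \<in> C" using red by (simp add: C_def braid_class_def)
    then show ?case by blast
  next
    case (4 w)
    then show ?case by (rule len)
  next
    case (5 w k)
    then show ?case using flip_move braid_class_closed[OF cox] by (auto simp: C_def)
  next
    case (6 u v)
    then have "(u, v) \<in> (braid_graph_edges S m \<alpha>)\<^sup>*"
      unfolding C_def by (rule braid_class_connected[OF cox red])
    then show ?case unfolding edges .
  next
    case (7 k)
    then have "{2*k + 1, 2*k + 2, 2*k + 3} \<in> class_shadows S m \<alpha>"
      using link_shadows(2)[OF cox assms(3), of "2*k"] len_\<alpha> by simp
    then obtain w where "w \<in> C" "{2*k + 1, 2*k + 2, 2*k + 3} \<in> braid_shadows m w"
      unfolding class_shadows_def C_def by blast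
    then show ?case
      using letter 7 unfolding mem_braid_shadows by (intro bexI[of _ w]) (auto simp: active_def E_def)
  next
    case (8 w k)
    show ?case
    proof
      assume "E (w ! (2*k + 1)) (w ! (2*k + 2))"
      then have "even (2*k + 1)"
        using 8 by (intro even_shadow[of w]) (simp_all add: E_def eval_nat_numeral)
      then show False by simp
    qed
  next
    case (9 w i)
    then show ?case using reduced_no_repeat[OF cox red_C] len by simp
  qed
  show ?thesis using median_flip_graph unfolding edges C_def .
qed

end
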